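(* Let $G$ be a finite simple connected graph with $n$ vertices and $m$ edges. Then $$\begin{aligned}F(G^{++-})={}&3(n-4)F(G)+3(n-4)^2M_1(G)+6(n-4)M_2(G)+\xi_4(G)\\&+3\,\mathrm{ReZG}_3(G)+nm^3+m(n-4)^3.\end{aligned}$$
   Context: For a finite simple graph $H$ with vertex set $V(H)$ and edge set $E(H)$, $d_H(v)$ denotes the degree of the vertex $v$ in $H$. The F-index of $H$ is $F(H)=\sum_{v\in V(H)} d_H(v)^3$. The first and second Zagreb indices are $M_1(H)=\sum_{v\in V(H)} d_H(v)^2$ and $M_2(H)=\sum_{uv\in E(H)} d_H(u)d_H(v)$. Further, $\xi_4(H)=\sum_{v\in V(H)} d_H(v)^4=\sum_{uv\in E(H)}[d_H(u)^3+d_H(v)^3]$ and $\mathrm{ReZG}_3(H)=\sum_{uv\in E(H)} d_H(u)d_H(v)[d_H(u)+d_H(v)]$. For $x,y,z\in\{+,-\}$, the total transformation graph $G^{xyz}$ is the simple graph with vertex set $V(G)\cup E(G)$ (disjoint union) in which two distinct elements $u,v$ are adjacent if and only if one of the following holds: (i) $u,v\in V(G)$, and $u,v$ are adjacent in $G$ if $x=+$, respectively not adjacent in $G$ if $x=-$; (ii) $u,v\in E(G)$, and $u,v$ are adjacent in $G$ (share an endpoint) if $y=+$, respectively not adjacent in $G$ if $y=-$; (iii) one of them is a vertex of $G$ and the other is an edge of $G$, and they are incident in $G$ if $z=+$, respectively not incident in $G$ if $z=-$. *)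

theory Defs
  imports Main
begin

record 'a graph =
  verts :: "'a set"
  edges :: "'a set set"

definition simple_graph :: "'a graph \<Rightarrow> bool" where
  "simple_graph G \<longleftrightarrow> finite (verts G) \<and> (\<forall>e\<in>edges G. e \<subseteq> verts G \<and> card e = 2)"

definition adj :: "'a graph \<Rightarrow> 'a \<Rightarrow> 'a \<Rightarrow> bool" where
  "adj G u v \<longleftrightarrow> {u, v} \<in> edges G"

(* The null graph is not regarded as connected. *)
definition connected_graph :: "'a graph \<Rightarrow> bool" where
  "connected_graph G \<longleftrightarrow> verts G \<noteq> {} \<and> (\<forall>u\<in>verts G. \<forall>v\<in>verts G. (adj G)\<^sup>*\<^sup>* u v)"

definition deg :: "'a graph \<Rightarrow> 'a \<Rightarrow> nat" where
  "deg G v = card {e \<in> edges G. v \<in> e}"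

definition F_index :: "'a graph \<Rightarrow> nat" where
  "F_index G = (\<Sum>v\<in>verts G. deg G v ^ 3)"

definition M1 :: "'a graph \<Rightarrow> nat" where
  "M1 G = (\<Sum>v\<in>verts G. deg G v ^ 2)"

(* An edge is the two-element set of its endpoints, so for e = {u, v} the product over e below
   is deg G u * deg G v and the sum over e is deg G u + deg G v. *)

definition M2 :: "'a graph \<Rightarrow> nat" where
  "M2 G = (\<Sum>e\<in>edges G. \<Prod>v\<in>e. deg G v)"

definition xi4 :: "'a graph \<Rightarrow> nat" where
  "xi4 G = (\<Sum>v\<in>verts G. deg G v ^ 4)"

definition ReZG3 :: "'a graph \<Rightarrow> nat" where
  "ReZG3 G = (\<Sum>e\<in>edges G. (\<Prod>v\<in>e. deg G v) * (\<Sum>v\<in>e. deg G v))"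

datatype sign = Plus | Minus

fun signed :: "sign \<Rightarrow> bool \<Rightarrow> bool" where
  "signed Plus P \<longleftrightarrow> P"
| "signed Minus P \<longleftrightarrow> \<not> P"

fun transform_adj :: "sign \<Rightarrow> sign \<Rightarrow> sign \<Rightarrow> 'a graph \<Rightarrow> 'a + 'a set \<Rightarrow> 'a + 'a set \<Rightarrow> bool" where
  "transform_adj x y z G (Inl u) (Inl v) \<longleftrightarrow> signed x (adj G u v)"
| "transform_adj x y z G (Inr e) (Inr f) \<longleftrightarrow> signed y (e \<inter> f \<noteq> {})"
| "transform_adj x y z G (Inl u) (Inr f) \<longleftrightarrow> signed z (u \<in> f)"
| "transform_adj x y z G (Inr e) (Inl v) \<longleftrightarrow> signed z (v \<in> e)"

definition total_transform :: "sign \<Rightarrow> sign \<Rightarrow> sign \<Rightarrow> 'a graph \<Rightarrow> ('a + 'a set) graph" where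
  "total_transform x y z G =
    \<lparr> verts = verts G <+> edges G,
      edges = {{p, q} | p q. p \<in> verts G <+> edges G \<and> q \<in> verts G <+> edges G \<and>
                 p \<noteq> q \<and> transform_adj x y z G p q} \<rparr>"

lemma deg_edge:
  assumes "u \<noteq> v"
  shows "(\<Prod>w\<in>{u, v}. deg G w) = deg G u * deg G v"
    and "(\<Sum>w\<in>{u, v}. deg G w) = deg G u + deg G v"
  using assms by auto

lemma transform_adj_sym: "transform_adj x y z G p q \<longleftrightarrow> transform_adj x y z G q p"
  by (cases p; cases q) (auto simp: adj_def insert_commute Int_commute)

lemma finite_edges: "simple_graph G \<Longrightarrow> finite (edges G)"
  unfolding simple_graph_def by (meson Pow_iff finite_Pow_iff finite_subset subsetI)

lemma simple_graph_total_transform: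
  assumes "simple_graph G"
  shows "simple_graph (total_transform x y z G)"
  using assms finite_edges[OF assms]
  unfolding simple_graph_def total_transform_def by (auto simp: card_insert_if)

lemma xi4_edges:
  assumes G: "simple_graph G"
  shows "xi4 G = (\<Sum>e\<in>edges G. \<Sum>v\<in>e. deg G v ^ 3)"
proof -
  have fin: "finite (verts G)" "finite (edges G)"
    using G finite_edges by (auto simp: simple_graph_def)
  have "(\<Sum>e\<in>edges G. \<Sum>v\<in>e. deg G v ^ 3)
      = (\<Sum>e\<in>edges G. \<Sum>v\<in>verts G. if v \<in> e then deg G v ^ 3 else 0)"
  proof (rule sum.cong[OF refl])
    fix e assume "e \<in> edges G"
    then have "verts G \<inter> e = e" using G by (auto simp: simple_graph_def)
    then show "(\<Sum>v\<in>e. deg G v ^ 3) = (\<Sum>v\<in>verts G. if v \<in> e then deg G v ^ 3 else 0)"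
      using fin by (simp add: sum.inter_restrict[symmetric])
  qed
  also have "\<dots> = (\<Sum>v\<in>verts G. \<Sum>e\<in>edges G. if v \<in> e then deg G v ^ 3 else 0)"
    by (rule sum.swap)
  also have "\<dots> = (\<Sum>v\<in>verts G. deg G v * deg G v ^ 3)"
    using fin by (simp add: sum.inter_filter[symmetric] deg_def)
  finally show ?thesis by (simp add: xi4_def power_Suc[symmetric] eval_nat_numeral)
qed

end

theory Submission imports Defs begin

text \<open>
  In \<open>G\<^bsup>++-\<^esup>\<close> a vertex \<open>v\<close> of \<open>G\<close> has \<open>d(v)\<close> neighbours among the vertices
  and \<open>m - d(v)\<close> among the edges, hence degree \<open>m\<close>; an edge \<open>uv\<close> of \<open>G\<close> meets
  \<open>d(u) + d(v) - 2\<close> other edges and avoids \<open>n - 2\<close> vertices, hence has degree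
  \<open>d(u) + d(v) + n - 4\<close>. The formula follows by expanding the cube of the latter and
  double counting: summing \<open>g(u) + g(v)\<close> over the edges \<open>uv\<close> weights each \<open>g(v)\<close>
  by \<open>d(v)\<close>.
\<close>

text \<open>Both sides sum \<open>g v\<close> over the incident pairs of a vertex and an edge. The
  weight \<open>g\<close> is kept general so that one exchange of sums serves the three powers of
  the degree that the expanded cube produces.\<close>

lemma sum_edges_endpoints:
  fixes g :: "'a \<Rightarrow> nat"
  assumes G: "simple_graph G"
  shows "(\<Sum>e\<in>edges G. \<Sum>v\<in>e. g v) = (\<Sum>v\<in>verts G. deg G v * g v)"
proof -
  have fin: "finite (verts G)" "finite (edges G)"
    using G finite_edges by (auto simp: simple_graph_def)
  have "(\<Sum>e\<in>edges G. \<Sum>v\<in>e. g v)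
      = (\<Sum>e\<in>edges G. \<Sum>v\<in>verts G. if v \<in> e then g v else 0)"
  proof (rule sum.cong[OF refl])
    fix e assume "e \<in> edges G"
    then have "verts G \<inter> e = e" using G by (auto simp: simple_graph_def)
    then show "(\<Sum>v\<in>e. g v) = (\<Sum>v\<in>verts G. if v \<in> e then g v else 0)"
      using fin by (simp add: sum.inter_restrict[symmetric])
  qed
  also have "\<dots> = (\<Sum>v\<in>verts G. \<Sum>e\<in>edges G. if v \<in> e then g v else 0)"
    by (rule sum.swap)
  also have "\<dots> = (\<Sum>v\<in>verts G. deg G v * g v)"
    using fin by (simp add: sum.inter_filter[symmetric] deg_def)
  finally show ?thesis .
qed

text \<open>An edge through \<open>v\<close> has exactly one other end, so \<open>w\<close> and
  \<open>{v, w}\<close> determine each other. Neighbour sets are easier to count in the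
  transformation graph, where they split along the disjoint sum of vertices and edges.\<close>

lemma deg_eq_card_neighbours:
  assumes G: "simple_graph G"
  shows "deg G v = card {w. {v, w} \<in> edges G}"
proof -
  have "bij_betw (\<lambda>w. {v, w}) {w. {v, w} \<in> edges G} {e \<in> edges G. v \<in> e}"
  proof (rule bij_betwI')
    fix e assume e: "e \<in> {e \<in> edges G. v \<in> e}"
    then have "card e = 2" using G by (auto simp: simple_graph_def)
    then obtain w where "e = {v, w}" using e by (auto simp: card_2_iff)
    then show "\<exists>w\<in>{w. {v, w} \<in> edges G}. e = {v, w}" using e by auto
  qed (auto simp: doubleton_eq_iff)
  then show ?thesis by (simp add: deg_def bij_betw_same_card)
qed

text \<open>An unordered pair may arise from the defining set in either order; symmetry of
  \<open>transform_adj\<close> makes the two readings agree.\<close>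

lemma edge_total_transform_iff:
  "{p, q} \<in> edges (total_transform x y z G) \<longleftrightarrow>
    p \<in> verts G <+> edges G \<and> q \<in> verts G <+> edges G \<and> p \<noteq> q \<and> transform_adj x y z G p q"
  using transform_adj_sym[of x y z G p q]
  by (simp add: total_transform_def doubleton_eq_iff) blast

lemma deg_total_transform_vertex:
  assumes G: "simple_graph G" and u: "u \<in> verts G"
  shows "deg (total_transform Plus y Minus G) (Inl u) = card (edges G)"
proof -
  let ?N = "{v. {u, v} \<in> edges G}" and ?A = "{e \<in> edges G. u \<in> e}" and ?B = "{e \<in> edges G. u \<notin> e}"
  have fin: "finite (verts G)" "finite (edges G)"
    using G finite_edges by (auto simp: simple_graph_def)
  \<comment> \<open>Since \<open>{u, u}\<close> has only one element, it is not an edge; so the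
    condition \<open>p \<noteq> q\<close> removes no neighbour of \<open>u\<close>.\<close>
  have N: "v \<in> verts G \<and> v \<noteq> u" if "{u, v} \<in> edges G" for v
    using G that by (auto simp: simple_graph_def)
  then have "finite ?N" by (auto intro: finite_subset[OF _ fin(1)])
  have "{q. {Inl u, q} \<in> edges (total_transform Plus y Minus G)} = ?N <+> ?B"
  proof (rule set_eqI)
    fix q show "q \<in> {q. {Inl u, q} \<in> edges (total_transform Plus y Minus G)} \<longleftrightarrow> q \<in> ?N <+> ?B"
      using u N by (cases q) (auto simp: edge_total_transform_iff adj_def)
  qed
  then have "deg (total_transform Plus y Minus G) (Inl u) = card ?N + card ?B"
    using \<open>finite ?N\<close> fin
    by (simp add: deg_eq_card_neighbours[OF simple_graph_total_transform[OF G]] card_Plus)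
  also have "card ?N = card ?A"
    using deg_eq_card_neighbours[OF G] by (simp add: deg_def)
  also have "card ?A + card ?B = card (?A \<union> ?B)"
    by (rule card_Un_disjoint[symmetric]) (use fin in auto)
  also have "?A \<union> ?B = edges G" by auto
  finally show ?thesis .
qed

text \<open>Stated over the integers because \<open>card (verts G) - 4\<close> is negative for
  graphs with two or three vertices.\<close>

lemma deg_total_transform_edge:
  assumes G: "simple_graph G" and e: "e \<in> edges G"
  shows "int (deg (total_transform x Plus Minus G) (Inr e))
    = (\<Sum>v\<in>e. int (deg G v)) + (int (card (verts G)) - 4)"
proof -
  have fin: "finite (verts G)" "finite (edges G)"
    using G finite_edges by (auto simp: simple_graph_def)
  have eV: "e \<subseteq> verts G" and "card e = 2" using G e by (auto simp: simple_graph_def)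
  then obtain a b where ab: "e = {a, b}" "a \<noteq> b" by (auto simp: card_2_iff)
  let ?A = "{f \<in> edges G. a \<in> f}" and ?B = "{f \<in> edges G. b \<in> f}"
  have ends: "a \<in> e" "b \<in> e" using ab by auto
  have "f = e" if "f \<in> edges G" "a \<in> f" "b \<in> f" for f
  proof -
    have "card f = 2" using that G by (auto simp: simple_graph_def)
    then show ?thesis using that ab by (auto simp: card_2_iff)
  qed
  \<comment> \<open>Only \<open>e\<close> contains both ends, so \<open>deg G a + deg G b\<close>
    counts it twice. Removing both occurrences, as \<open>e\<close> is not its own neighbour, and
    the two ends from the vertices yields the constant 4.\<close>
  then have AB: "?A \<inter> ?B = {e}" using ends e by blast
  have "{q. {Inr e, q} \<in> edges (total_transform x Plus Minus G)} = (verts G - e) <+> (?A \<union> ?B - {e})"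
  proof (rule set_eqI)
    fix q show "q \<in> {q. {Inr e, q} \<in> edges (total_transform x Plus Minus G)}
      \<longleftrightarrow> q \<in> (verts G - e) <+> (?A \<union> ?B - {e})"
      using e ab by (cases q) (auto simp: edge_total_transform_iff)
  qed
  then have "deg (total_transform x Plus Minus G) (Inr e) = card (verts G - e) + card (?A \<union> ?B - {e})"
    using fin by (simp add: deg_eq_card_neighbours[OF simple_graph_total_transform[OF G]] card_Plus)
  \<comment> \<open>The three counts are written additively to avoid truncated subtraction on
    \<open>nat\<close>.\<close>
  moreover have "card (verts G - e) + 2 = card (verts G)"
    using card_mono[OF fin(1) eV] \<open>card e = 2\<close> fin eV by (simp add: card_Diff_subset finite_subset)
  moreover have "card (?A \<union> ?B - {e}) + 1 = card (?A \<union> ?B)"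
    using card_Suc_Diff1[of "?A \<union> ?B" e] fin ab e by simp
  moreover have "card (?A \<union> ?B) + 1 = deg G a + deg G b"
    using card_Un_Int[of ?A ?B] fin AB by (simp add: deg_def)
  ultimately show ?thesis using ab by simp
qed

lemma total_transform_F_index_split:
  assumes G: "simple_graph G"
  shows "F_index (total_transform x y z G) =
    (\<Sum>u\<in>verts G. deg (total_transform x y z G) (Inl u) ^ 3)
    + (\<Sum>e\<in>edges G. deg (total_transform x y z G) (Inr e) ^ 3)"
proof -
  have "verts (total_transform x y z G) = verts G <+> edges G"
    by (simp add: total_transform_def)
  then show ?thesis
    using G finite_edges[OF G] by (simp add: F_index_def simple_graph_def sum.Plus comp_def)
qed

theorem theorem4:
  fixes G :: "'a graph" and n m :: nat
  assumes "simple_graph G" and "connected_graph G"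
    and "n = card (verts G)" and "m = card (edges G)"
  shows "int (F_index (total_transform Plus Plus Minus G)) =
      3 * (int n - 4) * int (F_index G) + 3 * (int n - 4) ^ 2 * int (M1 G)
      + 6 * (int n - 4) * int (M2 G) + int (xi4 G) + 3 * int (ReZG3 G)
      + int n * int m ^ 3 + int m * (int n - 4) ^ 3"
proof -
  let ?T = "total_transform Plus Plus Minus G"
  let ?S = "\<lambda>k e. int (\<Sum>v\<in>e. deg G v ^ k)" and ?P = "\<lambda>e. int (\<Prod>v\<in>e. deg G v)"
  define c where "c = int n - 4"
  note G = assms(1)
  \<comment> \<open>With \<open>e = {a, b}\<close>, the cross term of the squared degree sum gives
    \<open>6 * c * ?P e\<close>, and the mixed terms of its cube give the summand of
    \<open>ReZG3\<close>.\<close>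
  have cube: "int (deg ?T (Inr e)) ^ 3 =
      3 * c * ?S 2 e + 3 * c ^ 2 * ?S 1 e + 6 * c * ?P e + ?S 3 e
      + 3 * int ((\<Prod>v\<in>e. deg G v) * (\<Sum>v\<in>e. deg G v)) + c ^ 3"
    if e: "e \<in> edges G" for e
  proof -
    have "card e = 2" using G e by (auto simp: simple_graph_def)
    then obtain a b where "e = {a, b}" "a \<noteq> b" by (auto simp: card_2_iff)
    moreover have "int (deg ?T (Inr e)) = (\<Sum>v\<in>e. int (deg G v)) + c"
      using deg_total_transform_edge[OF G e] by (simp add: c_def assms(3))
    ultimately show ?thesis
      by (simp add: power2_eq_square power3_eq_cube algebra_simps)
  qed
  \<comment> \<open>Double counting raises the exponent by one, so the powers 1, 2, 3 lead to
    \<open>M1\<close>, \<open>F_index\<close> and \<open>xi4\<close>.\<close>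
  have S: "(\<Sum>e\<in>edges G. ?S k e) = int (\<Sum>v\<in>verts G. deg G v ^ Suc k)" for k
    using sum_edges_endpoints[OF G, of "\<lambda>v. deg G v ^ k"] by (simp flip: of_nat_sum)
  have S1: "(\<Sum>e\<in>edges G. ?S 1 e) = int (M1 G)"
    and S2: "(\<Sum>e\<in>edges G. ?S 2 e) = int (F_index G)"
    and S3: "(\<Sum>e\<in>edges G. ?S 3 e) = int (xi4 G)"
    unfolding S by (simp_all add: M1_def F_index_def xi4_def eval_nat_numeral)
  have "int (F_index ?T) = int n * int m ^ 3 + (\<Sum>e\<in>edges G. int (deg ?T (Inr e)) ^ 3)"
    by (simp add: total_transform_F_index_split[OF G] deg_total_transform_vertex[OF G] assms(3,4))
  also have "(\<Sum>e\<in>edges G. int (deg ?T (Inr e)) ^ 3) =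
      (\<Sum>e\<in>edges G. 3 * c * ?S 2 e + 3 * c ^ 2 * ?S 1 e + 6 * c * ?P e + ?S 3 e
        + 3 * int ((\<Prod>v\<in>e. deg G v) * (\<Sum>v\<in>e. deg G v)) + c ^ 3)"
    by (rule sum.cong[OF refl cube])
  also have "\<dots> = 3 * c * int (F_index G) + 3 * c ^ 2 * int (M1 G) + 6 * c * int (M2 G)
      + int (xi4 G) + 3 * int (ReZG3 G) + int m * c ^ 3"
    unfolding sum.distrib sum_distrib_left[symmetric] S1 S2 S3
    by (simp add: M2_def ReZG3_def assms(4))
  finally show ?thesis by (simp add: c_def)
qed

end
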